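(* For each $n$ consider a $GI/M/1/n$ queueing system whose interarrival distribution function $A=A_n$ and service rate $\mu=\mu_n$ may depend on $n$, and let $p_n$ be the loss probability of the $n$-th system (the one with buffer size $n$). Suppose the load of the $n$-th system is $\rho=\rho(n)=1-\epsilon$, where $\epsilon=\epsilon_n>0$, and that as $n\to\infty$ we have $\epsilon\to0$ and $\epsilon n\to C$ for some constant $C>0$. Assume that $\rho_3=\rho_3(n)$ is a bounded function of $n$ and that the limit $\widetilde\rho_2=\lim_{n\to\infty}\rho_2(n)$ exists. Then, as $n\to\infty$, $$p_n=\frac{\epsilon\, e^{-2C/\widetilde\rho_2}}{1-e^{-2C/\widetilde\rho_2}}\,[1+o(1)].$$
   Context: $GI/M/1/n$ queue: a single-server loss system in which interarrival times are i.i.d. nonnegative random variables with distribution function $A(x)$ having mean $1/\lambda$, $0<\lambda<\infty$; service times are i.i.d. exponential with parameter $\mu>0$, independent of arrivals; the system holds at most $n$ customers (the buffer size $n$ includes the position at the server), and customers arriving when the system is full are lost. Notation: $\alpha(s)=\int_0^\infty e^{-sx}\,dA(x)$; $\rho=\lambda/\mu$; $\rho_m=\mu^m\int_0^\infty x^m\,dA(x)$ for $m=1,2,\dots$ (so $\rho_1=\rho^{-1}$). When $A=A_n$ and $\mu=\mu_n$ depend on $n$, all these quantities depend on $n$, and $\rho_m(n)$ denotes $\rho_m$ computed for the $n$-th system. The loss probability $p_n$ is the stationary probability that an arriving customer finds the system (with buffer size $n$) full. It exists for every value of $\rho$ and is given by $$p_n=\frac{1}{\sum_{j=0}^n\pi_j},\qquad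 \sum_{j=0}^\infty\pi_jz^j=\frac{(1-z)\,\alpha(\mu-\mu z)}{\alpha(\mu-\mu z)-z},\quad |z|<\sigma,$$ where $\sigma$ is the minimum nonnegative solution of $z=\alpha(\mu-\mu z)$; $\sigma\in(0,1)$ if $\lambda<\mu$ and $\sigma=1$ otherwise. (Here $\alpha,\mu$, hence $\pi_j$ and $\sigma$, are those of the $n$-th system.) *)

theory Defs
  imports "HOL-Probability.Probability" "HOL-Library.Landau_Symbols"
begin

text \<open>
  The interarrival distribution is given by its law, a Borel probability measure \<open>A\<close> on the reals;
  the distribution function is \<open>cdf A\<close>.  The integrability and positivity conditions say
  that the mean \<open>1/\<lambda>\<close> satisfies \<open>0 < \<lambda> < \<infinity>\<close>.
\<close>

definition interarrival_law :: "real measure \<Rightarrow> bool" where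
  "interarrival_law A \<longleftrightarrow>
     real_distribution A \<and> (AE x in A. 0 \<le> x) \<and>
     integrable A (\<lambda>x. x) \<and> 0 < (\<integral>x. x \<partial>A)"

definition arrival_rate :: "real measure \<Rightarrow> real" where
  "arrival_rate A = 1 / (\<integral>x. x \<partial>A)"

definition load :: "real measure \<Rightarrow> real \<Rightarrow> real" where
  "load A \<mu> = arrival_rate A / \<mu>"

text \<open>The quantity \<open>\<rho>\<^sub>m\<close>.  It is meaningful only if the \<open>m\<close>-th moment is finite,
  since the Bochner integral of a non-integrable function is 0.\<close>

definition scaled_moment :: "nat \<Rightarrow> real measure \<Rightarrow> real \<Rightarrow> real" where
  "scaled_moment m A \<mu> = \<mu> ^ m * (\<integral>x. x ^ m \<partial>A)"

text \<open>
  One interarrival period of the queue: if \<open>m\<close> customers are present right after an arrival, then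
  \<open>(x, s)\<close> consists of the time \<open>x\<close> until the next arrival and, independently, i.i.d. exponential
  service times \<open>s 1, \<dots>, s m\<close> of the customers present.  By lack of memory, the
  residual service time \<open>s 1\<close> of the customer in service is again exponential with parameter \<open>\<mu>\<close>
  and independent of the past.
\<close>

definition period_space :: "real measure \<Rightarrow> real \<Rightarrow> nat \<Rightarrow> (real \<times> (nat \<Rightarrow> real)) measure" where
  "period_space A \<mu> m =
     A \<Otimes>\<^sub>M (\<Pi>\<^sub>M k\<in>{1..m}. density lborel (exponential_density \<mu>))"

definition departures :: "nat \<Rightarrow> real \<times> (nat \<Rightarrow> real) \<Rightarrow> nat" where
  "departures m = (\<lambda>(x, s). card {k \<in> {1..m}. (\<Sum>i=1..k. s i) \<le> x})"

text \<open>
  Transition probabilities of the chain recording the number of customers in the system found by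
  successive arrivals.  An arrival that finds \<open>i\<close> customers leaves \<open>min (i + 1) n\<close> customers
  behind it: it is lost if \<open>i = n\<close>.
\<close>

definition transition :: "nat \<Rightarrow> real measure \<Rightarrow> real \<Rightarrow> nat \<Rightarrow> nat \<Rightarrow> real" where
  "transition n A \<mu> i j =
     (let m = min (i + 1) n in
      measure (period_space A \<mu> m)
        {\<omega> \<in> space (period_space A \<mu> m). m - departures m \<omega> = j})"

definition stationary :: "nat \<Rightarrow> real measure \<Rightarrow> real \<Rightarrow> (nat \<Rightarrow> real) \<Rightarrow> bool" where
  "stationary n A \<mu> q \<longleftrightarrow>
     (\<forall>j\<le>n. 0 \<le> q j) \<and> (\<Sum>j\<le>n. q j) = 1 \<and>
     (\<forall>j\<le>n. q j = (\<Sum>i\<le>n. q i * transition n A \<mu> i j))"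

text \<open>The stationary distribution on \<open>{0..n}\<close> is unique, so the description below is proper.\<close>

definition loss_probability :: "nat \<Rightarrow> real measure \<Rightarrow> real \<Rightarrow> real" where
  "loss_probability n A \<mu> = (THE p. \<exists>q. stationary n A \<mu> q \<and> p = q n)"

end

theory Submission
  imports Defs
begin

text \<open>
  Let \<open>f k\<close> be the probability that at least \<open>k + 1\<close> services are completed during an interarrival
  time of a permanently busy server.  Read from the full state downwards and summed over tails, the
  balance equations say that \<open>p\<^sub>n = 1 / U (n - 1)\<close>, where \<open>U k = 1 + (\<Sum>j\<le>k. f (k - j) * U j)\<close> is
  the renewal function of the sequence \<open>f\<close>.  The mass of \<open>f\<close> is \<open>\<rho>\<^sub>1 = 1 + e\<close> with \<open>e = \<epsilon> / (1 - \<epsilon>)\<close>, its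
  first moment is \<open>\<kappa> = \<rho>\<^sub>2 / 2\<close>, and its second moment \<open>\<rho>\<^sub>3 / 3 + \<rho>\<^sub>2 / 2\<close> is bounded, so \<open>U\<close> is a
  slightly supercritical renewal function.  By the comparison principle for the renewal equation,
  \<open>U\<close> lies between explicit sub- and supersolutions \<open>a * exp (\<theta> * k) - b\<close> with \<open>\<theta>\<close> close to
  \<open>e / \<kappa>\<close> and \<open>a\<close>, \<open>b\<close> close to \<open>1 / e\<close>.  Hence \<open>e * U (n - 1)\<close> tends to
  \<open>exp (2 * C / \<rho>\<^sub>2) - 1\<close>.
\<close>

section \<open>Renewal sequences and the comparison principle\<close>

text \<open>For \<open>f = departure_tail A \<mu>\<close> this is the sequence \<open>\<pi>\<^sub>k\<close> of the loss formula
  \<open>p\<^sub>n = 1 / (\<Sum>j\<le>n. \<pi>\<^sub>j)\<close>.\<close>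

fun loss_weight :: "(nat \<Rightarrow> real) \<Rightarrow> nat \<Rightarrow> real" where
  "loss_weight f 0 = 1"
| "loss_weight f (Suc k) = (f k + (\<Sum>i<k. f (k - i) * loss_weight f (Suc i))) / (1 - f 0)"

declare loss_weight.simps(2) [simp del]

text \<open>The bound \<open>Suc k\<close> shifts the index by one: buffer size \<open>n\<close>
  corresponds to \<open>renewal_sum f (n - 1)\<close>. In this indexing the sums satisfy a renewal
  equation with constant forcing 1.\<close>

definition renewal_sum :: "(nat \<Rightarrow> real) \<Rightarrow> nat \<Rightarrow> real" where
  "renewal_sum f k = (\<Sum>i\<le>Suc k. loss_weight f i)"

lemma loss_weight_step:
  assumes "f 0 \<noteq> 1"
  shows "(1 - f 0) * loss_weight f (Suc k) = f k + (\<Sum>i<k. f (k - i) * loss_weight f (Suc i))"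
  using assms by (subst loss_weight.simps(2)) simp

text \<open>The implicit form in which the balance equations appear. The weights 0 and 1 carry the
  same coefficient \<open>f k\<close> because arrivals that find \<open>n\<close> or
  \<open>n - 1\<close> customers both leave \<open>n\<close> behind.\<close>

lemma loss_weight_Suc:
  assumes "f 0 \<noteq> 1"
  shows "loss_weight f (Suc k) = f k + (\<Sum>i\<le>k. f (k - i) * loss_weight f (Suc i))"
  using loss_weight_step[of f k, OF assms] by (simp add: lessThan_Suc_atMost[symmetric] algebra_simps)

lemma loss_weight_nonneg:
  assumes "\<And>j. 0 \<le> f j" "f 0 < 1"
  shows "0 \<le> loss_weight f k"
proof (induction k rule: less_induct)
  case (less k)
  show ?case
  proof (cases k)
    case (Suc l)
    have "0 \<le> (\<Sum>i<l. f (l - i) * loss_weight f (Suc i))"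
      by (intro sum_nonneg mult_nonneg_nonneg assms less) (simp add: Suc)
    then have "0 \<le> (1 - f 0) * loss_weight f k"
      using assms loss_weight_step[of f l] by (simp add: Suc)
    then show ?thesis using assms by (simp add: zero_le_mult_iff)
  qed simp
qed

text \<open>Each equation contains its newest value with net coefficient \<open>1 - f 0\<close>, so
  it can be solved for it. This yields uniqueness of the stationary distribution up to the factor
  \<open>y 0\<close>.\<close>

lemma loss_weight_unique:
  assumes f0: "f 0 \<noteq> 1"
    and y: "\<And>k. k < n \<Longrightarrow> y (Suc k) = y 0 * f k + (\<Sum>i\<le>k. f (k - i) * y (Suc i))"
    and "k \<le> n"
  shows "y k = y 0 * loss_weight f k"
  using \<open>k \<le> n\<close>
proof (induction k rule: less_induct)
  case (less k)
  show ?case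
  proof (cases k)
    case (Suc l)
    have "(\<Sum>i<l. f (l - i) * y (Suc i)) = (\<Sum>i<l. y 0 * (f (l - i) * loss_weight f (Suc i)))"
    proof (rule sum.cong)
      fix i
      assume "i \<in> {..<l}"
      then have "y (Suc i) = y 0 * loss_weight f (Suc i)"
        using less.prems Suc by (intro less.IH) auto
      then show "f (l - i) * y (Suc i) = y 0 * (f (l - i) * loss_weight f (Suc i))" by (simp only: mult.left_commute)
    qed simp
    moreover have "l < n" using less.prems Suc by simp
    from y[OF this] have "y (Suc l) = y 0 * f l + (\<Sum>i<l. f (l - i) * y (Suc i)) + f 0 * y (Suc l)"
      by (simp only: lessThan_Suc_atMost[symmetric] sum.lessThan_Suc diff_self_eq_0 add.assoc)
    ultimately have "(1 - f 0) * y (Suc l) = y 0 * ((1 - f 0) * loss_weight f (Suc l))"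
      unfolding loss_weight_step[of f, OF f0] by (simp add: sum_distrib_left algebra_simps)
    then show ?thesis using f0 by (simp add: Suc)
  qed simp
qed

lemma renewal_sum_eq:
  assumes "f 0 \<noteq> 1"
  shows "renewal_sum f k = 1 + (\<Sum>j\<le>k. f (k - j) * renewal_sum f j)"
proof (induction k)
  case 0
  show ?case
    using assms loss_weight_step[of f 0] by (simp add: renewal_sum_def field_simps)
next
  case (Suc k)
  have inc: "renewal_sum f (Suc j) = renewal_sum f j + loss_weight f (Suc (Suc j))" for j
    by (simp add: renewal_sum_def)
  have "(\<Sum>j\<le>Suc k. f (Suc k - j) * renewal_sum f j)
      = f (Suc k) * renewal_sum f 0 + (\<Sum>j\<le>k. f (k - j) * renewal_sum f (Suc j))"
    by (subst sum.atMost_Suc_shift) simp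
  also have "\<dots> = f (Suc k) * renewal_sum f 0 + (\<Sum>j\<le>k. f (k - j) * renewal_sum f j)
      + (\<Sum>j\<le>k. f (k - j) * loss_weight f (Suc (Suc j)))"
    by (simp add: inc sum.distrib algebra_simps)
  \<comment> \<open>\<open>renewal_sum f 0\<close> is \<open>1 + loss_weight f 1\<close>: the 1
    supplies the free term \<open>f (Suc k)\<close>, the weight supplies the term
    \<open>j = 0\<close> of the convolution.\<close>
  also have "\<dots> = f (Suc k) + (\<Sum>j\<le>Suc k. f (Suc k - j) * loss_weight f (Suc j))
      + (\<Sum>j\<le>k. f (k - j) * renewal_sum f j)"
    by (subst sum.atMost_Suc_shift) (simp add: renewal_sum_def algebra_simps)
  also have "f (Suc k) + (\<Sum>j\<le>Suc k. f (Suc k - j) * loss_weight f (Suc j)) = loss_weight f (Suc (Suc k))"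
    by (rule loss_weight_Suc[of f "Suc k", OF assms, symmetric])
  finally show ?case using Suc by (simp add: inc)
qed

text \<open>A minimum principle: nonnegativity of the earlier values passes to \<open>d k\<close>,
  since \<open>f 0 < 1\<close> allows the diagonal term to be absorbed. It is applied to differences
  from a sub- or supersolution, where the forcing 1 cancels.\<close>

lemma renewal_comparison:
  fixes d :: "nat \<Rightarrow> real"
  assumes "\<And>j. 0 \<le> f j" "f 0 < 1"
    and d: "\<And>k. (\<Sum>j\<le>k. f (k - j) * d j) \<le> d k"
  shows "0 \<le> d k"
proof (induction k rule: less_induct)
  case (less k)
  have "0 \<le> (\<Sum>j<k. f (k - j) * d j)"
    by (intro sum_nonneg mult_nonneg_nonneg assms less) simp
  also have "\<dots> \<le> (1 - f 0) * d k"
    using d[of k] by (simp add: lessThan_Suc_atMost[symmetric] algebra_simps)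
  finally show ?case using assms by (simp add: zero_le_mult_iff)
qed

lemma renewal_sum_ge:
  assumes "\<And>j. 0 \<le> f j" "f 0 < 1"
    and "\<And>k. g k \<le> 1 + (\<Sum>j\<le>k. f (k - j) * g j)"
  shows "g k \<le> renewal_sum f k"
proof -
  have "0 \<le> renewal_sum f k - g k"
  proof (rule renewal_comparison[of f, OF assms(1,2)])
    fix k
    show "(\<Sum>j\<le>k. f (k - j) * (renewal_sum f j - g j)) \<le> renewal_sum f k - g k"
      using assms(3)[of k] renewal_sum_eq[of f k] assms(2)
      by (simp only: right_diff_distrib sum_subtractf)
  qed
  then show ?thesis by simp
qed

lemma renewal_sum_le:
  assumes "\<And>j. 0 \<le> f j" "f 0 < 1"
    and "\<And>k. 1 + (\<Sum>j\<le>k. f (k - j) * g j) \<le> g k"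
  shows "renewal_sum f k \<le> g k"
proof -
  have "0 \<le> g k - renewal_sum f k"
  proof (rule renewal_comparison[of f, OF assms(1,2)])
    fix k
    show "(\<Sum>j\<le>k. f (k - j) * (g j - renewal_sum f j)) \<le> g k - renewal_sum f k"
      using assms(3)[of k] renewal_sum_eq[of f k] assms(2)
      by (simp only: right_diff_distrib sum_subtractf)
  qed
  then show ?thesis by simp
qed

text \<open>The renewal equation involves truncated convolutions, whereas moments are full series. A
  minorant that is nonpositive past the truncation point can be summed in full.\<close>

lemma sums_le_partial_sum:
  fixes h t :: "nat \<Rightarrow> real"
  assumes "h sums s" "\<And>j. j \<le> n \<Longrightarrow> h j \<le> t j" "\<And>j. n < j \<Longrightarrow> h j \<le> 0"
  shows "s \<le> (\<Sum>j\<le>n. t j)"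
proof -
  have "s \<le> (\<Sum>j\<le>n. h j)"
  proof (rule LIMSEQ_le_const2)
    show "(\<lambda>k. \<Sum>j<k. h j) \<longlonglongrightarrow> s" using assms(1) by (simp add: sums_def)
    have "(\<Sum>j<k. h j) \<le> (\<Sum>j\<le>n. h j)" if "Suc n \<le> k" for k
    proof -
      have "(\<Sum>j<k. h j) = (\<Sum>j\<in>{..n}. h j) + (\<Sum>j\<in>{n<..<k}. h j)"
        using that by (subst sum.union_disjoint[symmetric]) (auto intro!: sum.cong)
      moreover have "(\<Sum>j\<in>{n<..<k}. h j) \<le> 0" by (intro sum_nonpos assms) auto
      ultimately show ?thesis by simp
    qed
    then show "\<exists>N. \<forall>k\<ge>N. (\<Sum>j<k. h j) \<le> (\<Sum>j\<le>n. h j)" by blast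
  qed
  also have "\<dots> \<le> (\<Sum>j\<le>n. t j)" by (intro sum_mono assms) simp
  finally show ?thesis .
qed

lemma partial_sum_le_sums:
  fixes h t :: "nat \<Rightarrow> real"
  assumes "h sums s" "\<And>j. j \<le> n \<Longrightarrow> t j \<le> h j" "\<And>j. n < j \<Longrightarrow> 0 \<le> h j"
  shows "(\<Sum>j\<le>n. t j) \<le> s"
  using sums_le_partial_sum[of "\<lambda>j. - h j" "- s" n "\<lambda>j. - t j"] assms
  by (simp add: sums_minus sum_negf)

lemma sum_atMost_flip: "(\<Sum>j\<le>k. F (k - j) j) = (\<Sum>j\<le>(k::nat). F j (k - j))"
  by (rule sum.reindex_bij_witness[of _ "\<lambda>j. k - j" "\<lambda>j. k - j"]) auto

lemma exp_minus_le_quadratic: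
  fixes x :: real
  assumes "0 \<le> x"
  shows "exp (- x) \<le> 1 - x + x\<^sup>2 / 2"
proof -
  have "(\<lambda>x. 1 - x + x\<^sup>2 / 2 - exp (- x)) 0 \<le> (\<lambda>x. 1 - x + x\<^sup>2 / 2 - exp (- x)) x"
  proof (rule DERIV_nonneg_imp_nondecreasing[OF assms])
    fix t :: real
    have "((\<lambda>x. 1 - x + x\<^sup>2 / 2 - exp (- x)) has_real_derivative (t - 1 + exp (- t))) (at t)"
      by (auto intro!: derivative_eq_intros)
    moreover have "0 \<le> t - 1 + exp (- t)"
      using exp_ge_add_one_self[of "- t"] by simp
    ultimately show "\<exists>y. ((\<lambda>x. 1 - x + x\<^sup>2 / 2 - exp (- x)) has_real_derivative y) (at t) \<and> 0 \<le> y"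
      by blast
  qed
  then show ?thesis by simp
qed

section \<open>Exponential barriers for a slightly supercritical renewal function\<close>

locale supercritical_renewal =
  fixes f :: "nat \<Rightarrow> real" and e \<kappa> K :: real
  assumes f_nonneg: "\<And>j. 0 \<le> f j"
    and f_0: "f 0 < 1"
    and e_pos: "0 < e"
    and kappa_pos: "0 < \<kappa>"
    and mass: "f sums (1 + e)"
    and first_moment: "(\<lambda>j. real j * f j) sums \<kappa>"
    and second_moment: "(\<lambda>j. (real j)\<^sup>2 * f j) sums K"
begin

lemma sums_quadratic:
  "(\<lambda>j. f j * (a + b * real j + c * (real j)\<^sup>2)) sums (a * (1 + e) + b * \<kappa> + c * K)"
  using sums_add[OF sums_add[OF sums_mult[OF mass, of a] sums_mult[OF first_moment, of b]]
      sums_mult[OF second_moment, of c]]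
  by (simp add: algebra_simps)

text \<open>The tangent bound for the exponential reduces the convolution to mass and first moment.
  With the rate \<open>e / \<kappa>\<close> the slope term cancels the excess mass \<open>e\<close>
  in the coefficient of the exponential, which makes the left side a subsolution.\<close>

lemma renewal_sum_lower: "(exp (e / \<kappa> * real k) - 1) / e \<le> renewal_sum f k"
proof (rule renewal_sum_ge[where f = f and g = "\<lambda>k. (exp (e / \<kappa> * real k) - 1) / e", OF f_nonneg f_0])
  fix k
  define \<theta> where "\<theta> = e / \<kappa>"
  have "\<theta> > 0" using e_pos kappa_pos by (simp add: \<theta>_def)
  let ?E = "exp (\<theta> * real k)"
  have h: "f j * ((?E - 1) + (- \<theta> * ?E) * real j + 0 * (real j)\<^sup>2)
      \<le> f j * (exp (\<theta> * (real k - real j)) - 1)" for j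
  proof (rule mult_left_mono[OF _ f_nonneg])
    have "?E * (1 - \<theta> * real j) \<le> ?E * exp (- \<theta> * real j)"
      using exp_ge_add_one_self[of "- \<theta> * real j"] by (intro mult_left_mono) auto
    also have "\<dots> = exp (\<theta> * (real k - real j))"
      by (simp add: exp_add[symmetric] algebra_simps)
    finally show "(?E - 1) + (- \<theta> * ?E) * real j + 0 * (real j)\<^sup>2 \<le> exp (\<theta> * (real k - real j)) - 1"
      by (simp add: algebra_simps)
  qed
  have "(?E - 1) * (1 + e) + (- \<theta> * ?E) * \<kappa> + 0 * K
      \<le> (\<Sum>j\<le>k. f j * (exp (\<theta> * real (k - j)) - 1))"
  proof (rule sums_le_partial_sum[OF sums_quadratic])
    fix j
    show "f j * ((?E - 1) + (- \<theta> * ?E) * real j + 0 * (real j)\<^sup>2)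
        \<le> f j * (exp (\<theta> * real (k - j)) - 1)" if "j \<le> k"
      using h[of j] that by (simp add: of_nat_diff)
    \<comment> \<open>Past \<open>k\<close> the exponential is at most 1, so these terms are
      nonpositive and so is their linear minorant.\<close>
    assume "k < j"
    then have "exp (\<theta> * (real k - real j)) \<le> 1" using \<open>\<theta> > 0\<close> by (simp add: mult_le_0_iff)
    then have "f j * (exp (\<theta> * (real k - real j)) - 1) \<le> 0"
      using f_nonneg[of j] by (simp add: mult_le_0_iff)
    then show "f j * ((?E - 1) + (- \<theta> * ?E) * real j + 0 * (real j)\<^sup>2) \<le> 0"
      using h[of j] by linarith
  qed
  moreover have "(- \<theta> * ?E) * \<kappa> = - e * ?E" using kappa_pos by (simp add: \<theta>_def)
  ultimately have "(?E - 1) * (1 + e) + - e * ?E + 0 * K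
      \<le> (\<Sum>j\<le>k. f j * (exp (\<theta> * real (k - j)) - 1))"
    by (simp only:)
  then have "?E - 1 - e \<le> (\<Sum>j\<le>k. f j * (exp (\<theta> * real (k - j)) - 1))"
    by (simp add: algebra_simps)
  also have "\<dots> = (\<Sum>j\<le>k. f (k - j) * (exp (\<theta> * real j) - 1))"
    using sum_atMost_flip[of "\<lambda>i j. f i * (exp (\<theta> * real j) - 1)" k] by simp
  finally have "(?E - 1 - e) / e \<le> (\<Sum>j\<le>k. f (k - j) * (exp (\<theta> * real j) - 1)) / e"
    using e_pos by (simp add: divide_right_mono)
  also have "\<dots> = (\<Sum>j\<le>k. f (k - j) * ((exp (\<theta> * real j) - 1) / e))"
    by (simp add: sum_divide_distrib)
  finally show "(exp (e / \<kappa> * real k) - 1) / e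
      \<le> 1 + (\<Sum>j\<le>k. f (k - j) * ((exp (e / \<kappa> * real j) - 1) / e))"
    using e_pos unfolding \<theta>_def[symmetric] by (simp add: diff_divide_distrib)
qed

text \<open>The supersolution is \<open>A * exp (\<theta> * k) - B\<close>. Since
  \<open>\<theta> * \<kappa> = (1 + \<eta>) * e\<close>, the surplus \<open>\<eta> * e\<close> pays
  for the quadratic Taylor error (\<open>small1\<close>). Since \<open>B * e = 1 + \<eta>\<close>,
  there is room for the forcing 1 and for a correction \<open>D * j\<^sup>2\<close>
  (\<open>small2\<close>) that keeps the majorant nonnegative past the truncation point.\<close>

lemma renewal_sum_upper:
  assumes "\<eta> > 0"
  defines "\<theta> \<equiv> (1 + \<eta>) * e / \<kappa>"
  assumes small1: "\<theta>\<^sup>2 * K / 2 \<le> \<eta> * e"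
    and small2: "(1 + \<eta>) ^ 3 * \<theta>\<^sup>2 * K / (4 * \<eta> * e) \<le> \<eta>"
  shows "renewal_sum f k \<le> (1 + \<eta>) * ((1 + \<eta>) * exp (\<theta> * real k) - 1) / e"
proof -
  define B where "B = (1 + \<eta>) / e"
  define A where "A = (1 + \<eta>) * B"
  \<comment> \<open>The least coefficient for which
    \<open>(A - B) - A * \<theta> * x + D * x\<^sup>2\<close> is never negative: its discriminant
    vanishes.\<close>
  define D where "D = A\<^sup>2 * \<theta>\<^sup>2 / (4 * (A - B))"
  have "\<theta> > 0" using e_pos kappa_pos assms(1) by (simp add: \<theta>_def)
  have "B > 0" using e_pos assms(1) by (simp add: B_def)
  have AB: "A - B = \<eta> * B" by (simp add: A_def algebra_simps)
  have "A > 0" "A - B > 0" using \<open>B > 0\<close> assms(1) AB by (simp_all add: A_def)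
  have "D \<ge> 0" using \<open>A - B > 0\<close> by (simp add: D_def)
  have "D * K = (1 + \<eta>) ^ 3 * \<theta>\<^sup>2 * K / (4 * \<eta> * e)"
  proof -
    have "(u * (u / e))\<^sup>2 * t / (4 * (\<eta> * (u / e))) * K = u ^ 3 * t * K / (4 * \<eta> * e)"
      if "u > 0" for u t
      using that e_pos assms(1) by (simp add: field_simps power2_eq_square power3_eq_cube)
    from this[of "1 + \<eta>"] show ?thesis
      unfolding D_def AB using assms(1) by (simp add: A_def B_def)
  qed
  then have DK: "D * K \<le> \<eta>" using small2 by simp
  have "renewal_sum f k \<le> A * exp (\<theta> * real k) - B"
  proof (rule renewal_sum_le[where f = f and g = "\<lambda>k. A * exp (\<theta> * real k) - B", OF f_nonneg f_0])
    fix k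
    let ?E = "exp (\<theta> * real k)"
    let ?h = "\<lambda>j. f j * ((A * ?E - B) + (- A * ?E * \<theta>) * real j + (A * ?E * \<theta>\<^sup>2 / 2 + D) * (real j)\<^sup>2)"
    have q: "A * exp (\<theta> * (real k - real j)) + D * (real j)\<^sup>2
        \<le> A * ?E + (- A * ?E * \<theta>) * real j + (A * ?E * \<theta>\<^sup>2 / 2 + D) * (real j)\<^sup>2" for j
    proof -
      have "A * exp (\<theta> * (real k - real j)) = (A * ?E) * exp (- (\<theta> * real j))"
        by (simp add: exp_add[symmetric] algebra_simps)
      also have "\<dots> \<le> (A * ?E) * (1 - \<theta> * real j + (\<theta> * real j)\<^sup>2 / 2)"
        using \<open>A > 0\<close> \<open>\<theta> > 0\<close> by (intro mult_left_mono exp_minus_le_quadratic) auto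
      finally show ?thesis by (simp add: algebra_simps power_mult_distrib)
    qed
    have "(\<Sum>j\<le>k. f j * (A * exp (\<theta> * real (k - j)) - B))
        \<le> (A * ?E - B) * (1 + e) + (- A * ?E * \<theta>) * \<kappa> + (A * ?E * \<theta>\<^sup>2 / 2 + D) * K"
    proof (rule partial_sum_le_sums[OF sums_quadratic])
      fix j
      show "f j * (A * exp (\<theta> * real (k - j)) - B) \<le> ?h j" if "j \<le> k"
      proof (rule mult_left_mono[OF _ f_nonneg])
        have "0 \<le> D * (real j)\<^sup>2" using \<open>D \<ge> 0\<close> by simp
        then show "A * exp (\<theta> * real (k - j)) - B
            \<le> (A * ?E - B) + (- A * ?E * \<theta>) * real j + (A * ?E * \<theta>\<^sup>2 / 2 + D) * (real j)\<^sup>2"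
          using q[of j] that by (simp add: of_nat_diff)
      qed
      assume "k < j"
      define x where "x = real j - real k"
      have "0 \<le> x" "x \<le> real j" using \<open>k < j\<close> by (auto simp: x_def)
      \<comment> \<open>AM-GM: \<open>A \<theta> x \<le> (A - B) + (A \<theta> x)\<^sup>2 / (4 (A - B))\<close>\<close>
      have "B \<le> A - A * \<theta> * x + D * x\<^sup>2"
      proof -
        have "0 \<le> (A * \<theta> * x - 2 * (A - B))\<^sup>2 / (4 * (A - B))" using \<open>A - B > 0\<close> by simp
        also have "\<dots> = D * x\<^sup>2 - A * \<theta> * x + (A - B)"
          using \<open>A - B > 0\<close> by (simp add: D_def field_simps power2_eq_square)
        finally show ?thesis by simp
      qed
      also have "A - A * \<theta> * x \<le> A * exp (- (\<theta> * x))"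
        using exp_ge_add_one_self[of "- (\<theta> * x)"] \<open>A > 0\<close> mult_left_mono[of "1 - \<theta> * x" "exp (- (\<theta> * x))" A]
        by (simp add: algebra_simps)
      also have "D * x\<^sup>2 \<le> D * (real j)\<^sup>2"
        using \<open>0 \<le> x\<close> \<open>x \<le> real j\<close> \<open>D \<ge> 0\<close> by (intro mult_left_mono power_mono)
      finally have "B \<le> A * exp (\<theta> * (real k - real j)) + D * (real j)\<^sup>2"
        by (simp add: x_def algebra_simps)
      with q[of j] show "0 \<le> ?h j"
        by (intro mult_nonneg_nonneg f_nonneg) linarith
    qed
    also have "\<dots> = A * ?E * (1 + e - \<theta> * \<kappa> + \<theta>\<^sup>2 * K / 2) - B * (1 + e) + D * K"
      by (simp add: algebra_simps)
    also have "\<dots> \<le> A * ?E * 1 - B * (1 + e) + \<eta>"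
    proof -
      have "\<theta> * \<kappa> = e + \<eta> * e" using kappa_pos by (simp add: \<theta>_def field_simps)
      then have "A * ?E * (1 + e - \<theta> * \<kappa> + \<theta>\<^sup>2 * K / 2) \<le> A * ?E * 1"
        using small1 \<open>A > 0\<close> by (intro mult_left_mono) auto
      then show ?thesis using DK by linarith
    qed
    also have "B * (1 + e) = B + (1 + \<eta>)" using e_pos by (simp add: B_def field_simps)
    finally have "(\<Sum>j\<le>k. f j * (A * exp (\<theta> * real (k - j)) - B)) \<le> A * ?E - B - 1" by simp
    then show "1 + (\<Sum>j\<le>k. f (k - j) * (A * exp (\<theta> * real j) - B)) \<le> A * ?E - B"
      using sum_atMost_flip[of "\<lambda>i j. f i * (A * exp (\<theta> * real j) - B)" k] by simp
  qed
  also have "\<dots> = (1 + \<eta>) * ((1 + \<eta>) * exp (\<theta> * real k) - 1) / e"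
    by (simp add: A_def B_def right_diff_distrib diff_divide_distrib)
  finally show ?thesis .
qed

end

section \<open>Moments of the departure tails\<close>

text \<open>Nonnegative terms keep every partial sum below \<open>g\<close>, which therefore serves
  as dominating function. It is used both for integration in time and for integration against the
  interarrival law.\<close>

lemma sums_integral_nonneg:
  fixes h :: "nat \<Rightarrow> 'a \<Rightarrow> real"
  assumes [measurable]: "\<And>j. h j \<in> borel_measurable M"
    and nonneg: "\<And>j. AE x in M. 0 \<le> h j x"
    and sums: "AE x in M. (\<lambda>j. h j x) sums g x"
    and g: "integrable M g"
  shows "integrable M (h j)" and "(\<lambda>j. \<integral>x. h j x \<partial>M) sums (\<integral>x. g x \<partial>M)"
proof -
  have AE0: "AE x in M. \<forall>j. 0 \<le> h j x" using nonneg by (simp add: AE_all_countable)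
  have le: "AE x in M. \<forall>I. finite I \<longrightarrow> norm (\<Sum>j\<in>I. h j x) \<le> g x"
    using AE0 sums
  proof eventually_elim
    case (elim x)
    then show ?case
      using sum_le_suminf[of "\<lambda>j. h j x"] by (auto simp: sums_iff sum_nonneg abs_of_nonneg)
  qed
  have int: "integrable M (h j)" for j
  proof (rule Bochner_Integration.integrable_bound[OF g])
    show "AE x in M. norm (h j x) \<le> norm (g x)"
      using le
    proof eventually_elim
      case (elim x)
      from elim[rule_format, of "{j}"] show ?case by simp
    qed
  qed simp
  then show "integrable M (h j)" .
  have "(\<lambda>n. \<integral>x. (\<Sum>j<n. h j x) \<partial>M) \<longlonglongrightarrow> (\<integral>x. g x \<partial>M)"
  proof (rule integral_dominated_convergence[OF _ _ g])
    show "AE x in M. (\<lambda>n. \<Sum>j<n. h j x) \<longlonglongrightarrow> g x" using sums by (simp add: sums_def)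
    show "AE x in M. norm (\<Sum>j<n. h j x) \<le> g x" for n
      using le by eventually_elim simp
  qed (use g in auto)
  then show "(\<lambda>j. \<integral>x. h j x \<partial>M) sums (\<integral>x. g x \<partial>M)"
    using int by (simp add: sums_def)
qed

section \<open>Poisson moments and series of Erlang distribution functions\<close>

lemma poisson_weights_sums:
  fixes y :: real
  shows "(\<lambda>k. y ^ k * exp (- y) / fact k) sums 1" (is "?p sums _")
    and "(\<lambda>k. real k * (y ^ k * exp (- y) / fact k)) sums y"
    and "(\<lambda>k. (real k)\<^sup>2 * (y ^ k * exp (- y) / fact k)) sums (y\<^sup>2 + y)"
proof -
  show 0: "?p sums 1"
    using sums_mult2[OF exp_converges[of y], of "exp (- y)"]
    by (simp add: exp_minus_inverse field_simps scaleR_conv_of_real)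
  \<comment> \<open>This shift identity reduces each moment to the preceding ones.\<close>
  have Suc: "real (Suc k) * ?p (Suc k) = y * ?p k" for k
    by (simp add: divide_simps del: of_nat_Suc)
  show 1: "(\<lambda>k. real k * ?p k) sums y"
    using sums_mult[OF 0, of y] sums_Suc[of "\<lambda>k. real k * ?p k" y] by (simp only: Suc) simp
  have "(real (Suc k))\<^sup>2 * ?p (Suc k) = y * (real k * ?p k) + y * ?p k" for k
    using Suc[of k] by (simp only: power2_eq_square mult.assoc) (simp only: of_nat_Suc ring_distribs mult_1_left mult_ac add_ac)
  then show "(\<lambda>k. (real k)\<^sup>2 * ?p k) sums (y\<^sup>2 + y)"
    using sums_add[OF sums_mult[OF 1, of y] sums_mult[OF 0, of y]]
      sums_Suc[of "\<lambda>k. (real k)\<^sup>2 * ?p k" "y * y + y * 1"]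
    by (simp only:) (simp add: power2_eq_square)
qed

text \<open>At \<open>s \<ge> 0\<close> the Erlang density with index \<open>k\<close> is
  \<open>l\<close> times the Poisson weight of \<open>k\<close> with mean \<open>l * s\<close>.
  Summing under the integral leaves the integral of \<open>l * g\<close> over \<open>{0..x}\<close>,
  which is \<open>G x\<close>.\<close>

lemma sums_erlang_CDF:
  fixes g G :: "real \<Rightarrow> real"
  assumes l: "0 < l" and "0 \<le> x" and c: "\<And>k. 0 \<le> c k"
    and g: "\<And>s. 0 \<le> s \<Longrightarrow> (\<lambda>k. c k * ((l * s) ^ k * exp (- (l * s)) / fact k)) sums g s"
    and [measurable]: "g \<in> borel_measurable borel"
    and G: "\<And>s. 0 \<le> s \<Longrightarrow> (G has_real_derivative (l * g s)) (at s)" "G 0 = 0"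
  shows "(\<lambda>k. c k * erlang_CDF k l x) sums G x"
proof -
  have CDF: "has_bochner_integral lborel (\<lambda>s. erlang_density k l s * indicator {..x} s) (erlang_CDF k l x)" for k
  proof (rule has_bochner_integral_nn_integral)
    show "(\<integral>\<^sup>+ s. ennreal (erlang_density k l s * indicator {..x} s) \<partial>lborel) = ennreal (erlang_CDF k l x)"
      using nn_integral_erlang_density[OF l, of k x] l
      by (simp add: ennreal_mult'' ennreal_indicator)
  qed (use l in auto)
  have g0: "0 \<le> g s" if "0 \<le> s" for s
    using sums_le[OF _ sums_zero g[OF that]] c that l by auto
  have int: "has_bochner_integral lborel (\<lambda>s. (l * g s) * indicator {0..x} s) (G x - G 0)"
    using \<open>0 \<le> x\<close> l g0 G(1) by (intro has_bochner_integral_FTC_Icc_nonneg) auto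
  have "(\<lambda>k. \<integral>s. c k * (erlang_density k l s * indicator {..x} s) \<partial>lborel)
      sums (\<integral>s. (l * g s) * indicator {0..x} s \<partial>lborel)"
  proof (rule sums_integral_nonneg)
    show "AE s in lborel. (\<lambda>k. c k * (erlang_density k l s * indicator {..x} s))
        sums ((l * g s) * indicator {0..x} s)"
    proof (rule AE_I2)
      fix s
      have eq: "c k * (erlang_density k l s * indicator {..x} s)
          = (l * indicator {0..x} s) * (c k * ((l * s) ^ k * exp (- (l * s)) / fact k))" for k
        by (auto simp: erlang_density_def indicator_def power_mult_distrib)
      show "(\<lambda>k. c k * (erlang_density k l s * indicator {..x} s))
          sums ((l * g s) * indicator {0..x} s)"
      proof (cases "0 \<le> s")
        case True
        then show ?thesis
          using sums_mult[OF g[of s], of "l * indicator {0..x} s"]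
          by (simp only: eq mult_ac)
      qed (simp add: erlang_density_def)
    qed
  qed (use l c int in \<open>auto simp: has_bochner_integral_iff\<close>)
  then show ?thesis
    using CDF int G(2) by (simp add: has_bochner_integral_iff)
qed

text \<open>Tail-sum formulas: if N is Poisson with mean \<open>l * x\<close>, then
  \<open>erlang_CDF k l x\<close> is the probability of N > k, and the series are the expectations
  of N, N(N-1)/2 and (N-1)N(2N-1)/6.\<close>

lemma erlang_CDF_moment_sums:
  assumes l: "0 < l" and x: "0 \<le> x"
  shows "(\<lambda>k. erlang_CDF k l x) sums (l * x)"
    and "(\<lambda>k. real k * erlang_CDF k l x) sums ((l * x)\<^sup>2 / 2)"
    and "(\<lambda>k. (real k)\<^sup>2 * erlang_CDF k l x) sums ((l * x) ^ 3 / 3 + (l * x)\<^sup>2 / 2)"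
proof -
  show "(\<lambda>k. erlang_CDF k l x) sums (l * x)"
    using sums_erlang_CDF[OF l x, of "\<lambda>_. 1" "\<lambda>_. 1" "\<lambda>x. l * x"] poisson_weights_sums(1)
    by (auto intro!: derivative_eq_intros)
  show "(\<lambda>k. real k * erlang_CDF k l x) sums ((l * x)\<^sup>2 / 2)"
    by (rule sums_erlang_CDF[OF l x _ poisson_weights_sums(2)])
      (auto intro!: derivative_eq_intros simp: power2_eq_square)
  show "(\<lambda>k. (real k)\<^sup>2 * erlang_CDF k l x) sums ((l * x) ^ 3 / 3 + (l * x)\<^sup>2 / 2)"
    by (rule sums_erlang_CDF[OF l x _ poisson_weights_sums(3)])
      (auto intro!: derivative_eq_intros simp: power2_eq_square power3_eq_cube algebra_simps)
qed

lemma erlang_CDF_le_1: "erlang_CDF k l x \<le> 1" if "0 < l"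
  using that by (auto simp: erlang_CDF_def intro!: sum_nonneg)

lemma borel_measurable_erlang_CDF [measurable]: "erlang_CDF k l \<in> borel_measurable borel"
  unfolding erlang_CDF_def[abs_def] by measurable

text \<open>The sequence \<open>f\<close> of the overview. \<open>erlang_CDF k\<close> belongs to a
  sum of \<open>k + 1\<close> exponential times, so index \<open>k\<close> stands for at least
  \<open>k + 1\<close> completed services.\<close>

definition departure_tail :: "real measure \<Rightarrow> real \<Rightarrow> nat \<Rightarrow> real" where
  "departure_tail A \<mu> k = (\<integral>x. erlang_CDF k \<mu> x \<partial>A)"

locale interarrival = real_distribution A for A :: "real measure" +
  fixes \<mu> :: real
  assumes AE_nonneg: "AE x in A. 0 \<le> x"
    and mu_pos: "0 < \<mu>"
begin

lemma integrable_erlang_CDF: "integrable A (erlang_CDF k \<mu>)"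
  by (rule integrable_const_bound[where B = 1])
    (use mu_pos erlang_CDF_le_1 in auto)

lemma departure_tail_nonneg: "0 \<le> departure_tail A \<mu> k"
  unfolding departure_tail_def using mu_pos by (intro integral_nonneg_AE) simp

lemma departure_tail_0: "departure_tail A \<mu> 0 < 1"
proof -
  have "(\<integral>x. erlang_CDF 0 \<mu> x \<partial>A) < (\<integral>x. 1 \<partial>A)"
    by (rule integral_less_AE_space[OF integrable_erlang_CDF])
      (use emeasure_space_1 in \<open>auto simp: erlang_CDF_0\<close>)
  then show ?thesis using prob_space by (simp add: departure_tail_def)
qed

lemma departure_tail_sums:
  assumes "\<And>k. 0 \<le> c k" "\<And>x. 0 \<le> x \<Longrightarrow> (\<lambda>k. c k * erlang_CDF k \<mu> x) sums g x" "integrable A g"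
  shows "(\<lambda>k. c k * departure_tail A \<mu> k) sums (\<integral>x. g x \<partial>A)"
proof -
  have "(\<lambda>k. \<integral>x. c k * erlang_CDF k \<mu> x \<partial>A) sums (\<integral>x. g x \<partial>A)"
  proof (rule sums_integral_nonneg)
    show "AE x in A. (\<lambda>k. c k * erlang_CDF k \<mu> x) sums g x"
      using AE_nonneg by eventually_elim (rule assms)
  qed (use assms mu_pos in auto)
  then show ?thesis by (simp add: departure_tail_def)
qed

lemma integrable_square:
  assumes i1: "integrable A (\<lambda>x. x)" and i3: "integrable A (\<lambda>x. x ^ 3)"
  shows "integrable A (\<lambda>x. x\<^sup>2)"
proof (rule Bochner_Integration.integrable_bound)
  show "integrable A (\<lambda>x. \<bar>x\<bar> + \<bar>x ^ 3\<bar>)" using i1 i3 by (intro Bochner_Integration.integrable_add integrable_abs)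
  have "x\<^sup>2 \<le> \<bar>x\<bar> + \<bar>x ^ 3\<bar>" for x :: real
  proof (cases "\<bar>x\<bar> \<le> 1")
    case True
    then have "\<bar>x\<bar> * \<bar>x\<bar> \<le> \<bar>x\<bar> * 1" by (intro mult_left_mono) auto
    then show ?thesis by (simp add: power2_eq_square)
  next
    case False
    then have "\<bar>x\<bar>\<^sup>2 \<le> \<bar>x\<bar> ^ 3" by (intro power_increasing) auto
    then show ?thesis by (simp add: power_abs)
  qed
  then show "AE x in A. norm (x\<^sup>2) \<le> norm (\<bar>x\<bar> + \<bar>x ^ 3\<bar>)" by simp
qed simp

lemma departure_tail_moment_sums:
  assumes i1: "integrable A (\<lambda>x. x)" and i3: "integrable A (\<lambda>x. x ^ 3)"
  shows "departure_tail A \<mu> sums scaled_moment 1 A \<mu>"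
    and "(\<lambda>k. real k * departure_tail A \<mu> k) sums (scaled_moment 2 A \<mu> / 2)"
    and "(\<lambda>k. (real k)\<^sup>2 * departure_tail A \<mu> k)
      sums (scaled_moment 3 A \<mu> / 3 + scaled_moment 2 A \<mu> / 2)"
proof -
  have i2: "integrable A (\<lambda>x. x\<^sup>2)" by (rule integrable_square[OF i1 i3])
  show "departure_tail A \<mu> sums scaled_moment 1 A \<mu>"
    using departure_tail_sums[of "\<lambda>_. 1" "\<lambda>x. \<mu> * x"] erlang_CDF_moment_sums(1)[OF mu_pos] i1
    by (simp add: scaled_moment_def)
  show "(\<lambda>k. real k * departure_tail A \<mu> k) sums (scaled_moment 2 A \<mu> / 2)"
    using departure_tail_sums[OF _ erlang_CDF_moment_sums(2)[OF mu_pos]] i2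
    by (simp add: scaled_moment_def power_mult_distrib)
  show "(\<lambda>k. (real k)\<^sup>2 * departure_tail A \<mu> k)
      sums (scaled_moment 3 A \<mu> / 3 + scaled_moment 2 A \<mu> / 2)"
    using departure_tail_sums[OF _ erlang_CDF_moment_sums(3)[OF mu_pos]] i2 i3
    by (simp add: scaled_moment_def power_mult_distrib)
qed

text \<open>Integrate \<open>(\<mu> * x - 1)\<^sup>2 \<ge> 0\<close>. When
  \<open>\<rho>\<^sub>1 \<ge> 1\<close>, this keeps \<open>\<rho>\<^sub>2\<close> at least 1, so
  \<open>\<kappa>\<close> cannot degenerate.\<close>

lemma scaled_moment_2_ge:
  assumes i1: "integrable A (\<lambda>x. x)" and i3: "integrable A (\<lambda>x. x ^ 3)"
  shows "2 * scaled_moment 1 A \<mu> - 1 \<le> scaled_moment 2 A \<mu>"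
proof -
  have i2: "integrable A (\<lambda>x. x\<^sup>2)" by (rule integrable_square[OF i1 i3])
  have "(\<integral>x. 2 * (\<mu> * x) - 1 \<partial>A) \<le> (\<integral>x. \<mu>\<^sup>2 * x\<^sup>2 \<partial>A)"
  proof (rule integral_mono)
    show "2 * (\<mu> * x) - 1 \<le> \<mu>\<^sup>2 * x\<^sup>2" for x
      using zero_le_power2[of "\<mu> * x - 1"] by (simp add: power2_eq_square algebra_simps)
  qed (use i1 i2 in auto)
  then show ?thesis using i1 prob_space by (simp add: scaled_moment_def)
qed

end

section \<open>Transition probabilities\<close>

context interarrival
begin

abbreviation service_law :: "real measure" where
  "service_law \<equiv> density lborel (exponential_density \<mu>)"

abbreviation services :: "nat \<Rightarrow> (nat \<Rightarrow> real) measure" where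
  "services m \<equiv> (\<Pi>\<^sub>M k\<in>{1..m}. service_law)"

lemma prob_space_service_law: "prob_space service_law"
  using mu_pos by (rule prob_space_exponential_density)

lemma prob_space_services: "prob_space (services m)"
  by (intro prob_space_PiM prob_space_service_law)

lemma prob_space_period_space: "prob_space (period_space A \<mu> m)"
  unfolding period_space_def
  by (intro prob_space_pair prob_space_services prob_space_axioms)

lemma distr_service:
  assumes "i \<in> {1..m}"
  shows "distr (services m) borel (\<lambda>s. s i) = service_law"
proof -
  have "distr (services m) borel (\<lambda>s. s i) = distr (services m) service_law (\<lambda>s. s i)"
    by (intro distr_cong) auto
  then show ?thesis
    using distr_PiM_component[of "{1..m}" "\<lambda>_. service_law" i] prob_space_service_law assms by simp
qed

lemma measurable_interarrival_time [measurable]: "fst \<in> borel_measurable (period_space A \<mu> m)"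
proof -
  have "fst \<in> measurable (period_space A \<mu> m) A" by (simp add: period_space_def)
  then show ?thesis by (simp cong: measurable_cong_sets)
qed

lemma measurable_service_time [measurable]:
  assumes "i \<in> {1..m}"
  shows "(\<lambda>\<omega>. snd \<omega> i) \<in> borel_measurable (period_space A \<mu> m)"
proof -
  have "(\<lambda>\<omega>. snd \<omega> i) \<in> measurable (period_space A \<mu> m) service_law"
    unfolding period_space_def
    by (rule measurable_compose[OF measurable_snd measurable_component_singleton[OF assms]])
  then show ?thesis by (simp cong: measurable_cong_sets)
qed

text \<open>Independence is read off from the joint law being the product of its marginals;
  \<open>1 \<le> m\<close> makes the index set nonempty, as this characterisation requires.\<close>

lemma indep_services:
  assumes "1 \<le> m"
  shows "prob_space.indep_vars (services m) (\<lambda>_. borel) (\<lambda>i s. s i) {1..m}"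
proof -
  interpret P: prob_space "services m" by (rule prob_space_services)
  \<comment> \<open>\<open>service_law\<close> has the Borel sets as its measurable sets, so the
    joint law is the same with \<open>borel\<close> as target.\<close>
  have s: "sets (\<Pi>\<^sub>M i\<in>{1..m}. borel) = sets (services m)" by (intro sets_PiM_cong) auto
  have "distr (services m) (\<Pi>\<^sub>M i\<in>{1..m}. borel) (\<lambda>s. \<lambda>i\<in>{1..m}. s i)
      = distr (services m) (services m) (\<lambda>s. s)"
    using s by (intro distr_cong) (auto simp: space_PiM extensional_restrict)
  also have "\<dots> = services m" by (simp add: distr_id)
  also have "\<dots> = (\<Pi>\<^sub>M i\<in>{1..m}. distr (services m) borel (\<lambda>s. s i))"
    by (intro PiM_cong refl distr_service[symmetric])
  finally show ?thesis
    using assms by (subst P.indep_vars_iff_distr_eq_PiM') auto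
qed

text \<open>A sum of \<open>k\<close> independent exponential times has the Erlang law of shape
  \<open>k\<close>, which is indexed by \<open>k - 1\<close>.\<close>

lemma emeasure_partial_service_le:
  assumes "1 \<le> k" "k \<le> m"
  shows "emeasure (services m) {s \<in> space (services m). (\<Sum>i=1..k. s i) \<le> x}
    = ennreal (erlang_CDF (k - 1) \<mu> x)"
proof -
  interpret P: prob_space "services m" by (rule prob_space_services)
  have m: "(\<lambda>s. \<Sum>i=1..k. s i) \<in> borel_measurable (services m)"
    using assms by (intro borel_measurable_sum) auto
  have "distributed (services m) lborel (\<lambda>s. \<Sum>i=1..k. s i) (erlang_density (card {1..k} - 1) \<mu>)"
  proof (rule P.exponential_distributed_sum)
    show "P.indep_vars (\<lambda>_. borel) (\<lambda>i s. s i) {1..k}"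
      using assms by (intro P.indep_vars_subset[OF indep_services]) auto
    fix i
    assume "i \<in> {1..k}"
    then have "i \<in> {1..m}" using assms by auto
    then show "distributed (services m) lborel (\<lambda>s. s i) (exponential_density \<mu>)"
      using distr_service[of i m] mu_pos
      unfolding distributed_def by (auto cong: distr_cong)
  qed (use assms mu_pos in auto)
  then have "distr (services m) lborel (\<lambda>s. \<Sum>i=1..k. s i) = density lborel (erlang_density (k - 1) \<mu>)"
    by (simp add: distributed_def)
  then have "emeasure (distr (services m) lborel (\<lambda>s. \<Sum>i=1..k. s i)) {..x} = ennreal (erlang_CDF (k - 1) \<mu> x)"
    using emeasure_erlang_density[OF mu_pos] by simp
  then show ?thesis
    using m by (subst (asm) emeasure_distr) (auto simp: vimage_def Int_def conj_commute)
qed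

text \<open>Nonnegative service times make the partial sums monotone, so the indices counted by
  \<open>departures\<close> form an initial segment of \<open>{1..m}\<close>; it has at least
  \<open>k\<close> elements exactly if it contains \<open>k\<close>.\<close>

lemma departures_ge_iff:
  assumes nonneg: "\<forall>i\<in>{1..m}. 0 \<le> s i" and k: "1 \<le> k" "k \<le> m"
  shows "k \<le> departures m (x, s) \<longleftrightarrow> (\<Sum>i=1..k. s i) \<le> x"
proof -
  let ?S = "{k \<in> {1..m}. (\<Sum>i=1..k. s i) \<le> x}"
  have mono: "(\<Sum>i=1..j. s i) \<le> (\<Sum>i=1..l. s i)" if "j \<le> l" "l \<le> m" for j l
    using nonneg that by (intro sum_mono2) auto
  have "k \<le> card ?S" if "(\<Sum>i=1..k. s i) \<le> x"
  proof -
    have "{1..k} \<subseteq> ?S" using mono[of _ k] that k by fastforce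
    then have "card {1..k} \<le> card ?S" by (intro card_mono) auto
    then show ?thesis by simp
  qed
  moreover have "card ?S < k" if "\<not> (\<Sum>i=1..k. s i) \<le> x"
  proof -
    have "j < k" if "j \<in> ?S" for j
      using mono[of k j] that \<open>\<not> (\<Sum>i=1..k. s i) \<le> x\<close> by (cases "j < k") auto
    then have "?S \<subseteq> {1..<k}" by auto
    then have "card ?S \<le> card {1..<k}" by (intro card_mono) auto
    then show ?thesis using k by simp
  qed
  ultimately show ?thesis by (force simp: departures_def)
qed

lemma measurable_departures [measurable]:
  "departures m \<in> measurable (period_space A \<mu> m) (count_space UNIV)"
proof -
  have "departures m = (\<lambda>\<omega>. \<Sum>k\<in>{1..m}. if (\<Sum>i=1..k. snd \<omega> i) \<le> fst \<omega> then 1 else 0)"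
    by (auto simp: departures_def fun_eq_iff sum.If_cases Int_def)
  moreover have "Measurable.pred (period_space A \<mu> m) (\<lambda>\<omega>. (\<Sum>i=1..k. snd \<omega> i) \<le> fst \<omega>)"
    if "k \<in> {1..m}" for k
  proof -
    have [measurable]: "(\<lambda>\<omega>. \<Sum>i=1..k. snd \<omega> i) \<in> borel_measurable (period_space A \<mu> m)"
      using that by (intro borel_measurable_sum measurable_service_time) auto
    show ?thesis by measurable
  qed
  ultimately show ?thesis by (simp add: borel_measurable_sum measurable_If)
qed

text \<open>Almost surely all service times are nonnegative, so the event may be replaced by a
  comparison of one partial sum with the interarrival time. Fubini then integrates the Erlang
  distribution function against \<open>A\<close>.\<close>

lemma prob_departures_ge:
  assumes k: "1 \<le> k" "k \<le> m"
  shows "measure (period_space A \<mu> m) {\<omega> \<in> space (period_space A \<mu> m). k \<le> departures m \<omega>}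
    = departure_tail A \<mu> (k - 1)"
proof -
  interpret S: prob_space "services m" by (rule prob_space_services)
  interpret P: prob_space "period_space A \<mu> m" by (rule prob_space_period_space)
  interpret pair: pair_sigma_finite A "services m" ..
  have [measurable]: "(\<lambda>\<omega>. \<Sum>i=1..k. snd \<omega> i) \<in> borel_measurable (period_space A \<mu> m)"
    using k by (intro borel_measurable_sum measurable_service_time) auto
  have service_nonneg: "AE s in services m. \<forall>i\<in>{1..m}. 0 \<le> s i"
  proof (rule AE_finite_allI)
    fix i
    assume i: "i \<in> {1..m}"
    have "AE t in service_law. 0 \<le> t"
      using mu_pos by (simp add: AE_density erlang_density_def)
    then show "AE s in services m. 0 \<le> s i"
      using AE_PiM_component[of "{1..m}" "\<lambda>_. service_law" i "\<lambda>t. 0 \<le> t"] prob_space_service_law i by auto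
  qed simp
  have "AE \<omega> in period_space A \<mu> m. \<forall>i\<in>{1..m}. 0 \<le> snd \<omega> i"
    unfolding period_space_def
  proof (rule pair.AE_pair_measure)
    have "{\<omega> \<in> space (period_space A \<mu> m). \<forall>i\<in>{1..m}. 0 \<le> snd \<omega> i} \<in> sets (period_space A \<mu> m)"
      by measurable
    then show "{\<omega> \<in> space (A \<Otimes>\<^sub>M services m). \<forall>i\<in>{1..m}. 0 \<le> snd \<omega> i} \<in> sets (A \<Otimes>\<^sub>M services m)"
      by (simp only: period_space_def)
  qed (use service_nonneg in auto)
  then have "measure (period_space A \<mu> m) {\<omega> \<in> space (period_space A \<mu> m). k \<le> departures m \<omega>}
      = measure (period_space A \<mu> m) {\<omega> \<in> space (period_space A \<mu> m). (\<Sum>i=1..k. snd \<omega> i) \<le> fst \<omega>}"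
  proof (intro P.finite_measure_eq_AE)
    show "{\<omega> \<in> space (period_space A \<mu> m). k \<le> departures m \<omega>} \<in> P.events"
      "{\<omega> \<in> space (period_space A \<mu> m). (\<Sum>i=1..k. snd \<omega> i) \<le> fst \<omega>} \<in> P.events"
      by measurable
    assume "AE \<omega> in period_space A \<mu> m. \<forall>i\<in>{1..m}. 0 \<le> snd \<omega> i"
    then show "AE \<omega> in period_space A \<mu> m.
        (\<omega> \<in> {\<omega> \<in> space (period_space A \<mu> m). k \<le> departures m \<omega>})
        = (\<omega> \<in> {\<omega> \<in> space (period_space A \<mu> m). (\<Sum>i=1..k. snd \<omega> i) \<le> fst \<omega>})"
    proof eventually_elim
      case (elim \<omega>)
      then show ?case using departures_ge_iff[OF elim k, of "fst \<omega>"] by simp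
    qed
  qed
  also have "ennreal \<dots> = emeasure (A \<Otimes>\<^sub>M services m) {\<omega> \<in> space (A \<Otimes>\<^sub>M services m). (\<Sum>i=1..k. snd \<omega> i) \<le> fst \<omega>}"
    unfolding P.emeasure_eq_measure[symmetric] by (simp only: period_space_def)
  also have "\<dots> = (\<integral>\<^sup>+x. emeasure (services m) {s \<in> space (services m). (\<Sum>i=1..k. s i) \<le> x} \<partial>A)"
  proof (subst S.emeasure_pair_measure_alt)
    have "{\<omega> \<in> space (period_space A \<mu> m). (\<Sum>i=1..k. snd \<omega> i) \<le> fst \<omega>} \<in> sets (period_space A \<mu> m)"
      by measurable
    then show "{\<omega> \<in> space (A \<Otimes>\<^sub>M services m). (\<Sum>i=1..k. snd \<omega> i) \<le> fst \<omega>} \<in> sets (A \<Otimes>\<^sub>M services m)"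
      by (simp only: period_space_def)
  qed (auto intro!: nn_integral_cong arg_cong2[where f = emeasure] simp: space_pair_measure)
  also have "\<dots> = (\<integral>\<^sup>+x. ennreal (erlang_CDF (k - 1) \<mu> x) \<partial>A)"
    by (simp only: emeasure_partial_service_le[OF k])
  also have "\<dots> = ennreal (departure_tail A \<mu> (k - 1))"
    unfolding departure_tail_def using mu_pos
    by (intro nn_integral_eq_integral integrable_erlang_CDF) simp
  finally show ?thesis
    by (simp add: departure_tail_nonneg)
qed

text \<open>At least \<open>j\<close> customers remain exactly if fewer than
  \<open>m - j + 1\<close> depart. The assumption \<open>1 \<le> j\<close> keeps this number within
  the range \<open>{1..m}\<close> of \<open>prob_departures_ge\<close>, whose index shift turns it
  into \<open>m - j\<close>.\<close>

lemma sum_transition: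
  assumes "1 \<le> j" and "i \<le> n" and "m = min (i + 1) n"
  shows "(\<Sum>l=j..n. transition n A \<mu> i l) = (if j \<le> m then 1 - departure_tail A \<mu> (m - j) else 0)"
proof -
  interpret P: prob_space "period_space A \<mu> m" by (rule prob_space_period_space)
  let ?Q = "period_space A \<mu> m"
  have "(\<Sum>l=j..n. transition n A \<mu> i l)
      = (\<Sum>l\<in>{j..n}. measure ?Q {\<omega> \<in> space ?Q. m - departures m \<omega> = l})"
    using assms by (simp add: transition_def Let_def)
  also have "\<dots> = measure ?Q (\<Union>l\<in>{j..n}. {\<omega> \<in> space ?Q. m - departures m \<omega> = l})"
    by (intro P.finite_measure_finite_Union[symmetric]) (auto simp: disjoint_family_on_def)
  also have "(\<Union>l\<in>{j..n}. {\<omega> \<in> space ?Q. m - departures m \<omega> = l})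
      = {\<omega> \<in> space ?Q. j \<le> m - departures m \<omega>}"
    using assms by auto
  also have "measure ?Q \<dots> = (if j \<le> m then 1 - departure_tail A \<mu> (m - j) else 0)"
  proof (cases "j \<le> m")
    case True
    have "{\<omega> \<in> space ?Q. j \<le> m - departures m \<omega>}
        = space ?Q - {\<omega> \<in> space ?Q. m - j + 1 \<le> departures m \<omega>}"
      using True \<open>1 \<le> j\<close> by auto
    then show ?thesis
      using True \<open>1 \<le> j\<close> by (simp add: P.prob_compl prob_departures_ge del: Suc_eq_plus1 add_Suc_right)
  next
    case False
    then have "{\<omega> \<in> space ?Q. j \<le> m - departures m \<omega>} = {}" by auto
    then have "measure ?Q {\<omega> \<in> space ?Q. j \<le> m - departures m \<omega>} = 0" by (simp only: measure_empty)
    then show ?thesis using False by simp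
  qed
  finally show ?thesis .
qed

lemma sum_transition_all:
  assumes "i \<le> n"
  shows "(\<Sum>l\<le>n. transition n A \<mu> i l) = 1"
proof -
  define m where "m = min (i + 1) n"
  interpret P: prob_space "period_space A \<mu> m" by (rule prob_space_period_space)
  let ?Q = "period_space A \<mu> m"
  have "(\<Sum>l\<le>n. transition n A \<mu> i l)
      = (\<Sum>l\<in>{..n}. measure ?Q {\<omega> \<in> space ?Q. m - departures m \<omega> = l})"
    by (simp add: transition_def Let_def m_def)
  also have "\<dots> = measure ?Q (\<Union>l\<in>{..n}. {\<omega> \<in> space ?Q. m - departures m \<omega> = l})"
    by (intro P.finite_measure_finite_Union[symmetric]) (auto simp: disjoint_family_on_def)
  also have "(\<Union>l\<in>{..n}. {\<omega> \<in> space ?Q. m - departures m \<omega> = l}) = space ?Q"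
    by (auto simp: m_def)
  finally show ?thesis by (simp add: P.prob_space)
qed

end

section \<open>Stationary distribution and critical asymptotics\<close>

text \<open>Consecutive tails differ by a single value. The balance equations are passed to tails
  because \<open>sum_transition\<close> evaluates these in closed form.\<close>

lemma all_tail_sums_eq_iff:
  fixes v w :: "nat \<Rightarrow> real"
  shows "(\<forall>j\<le>n. v j = w j) \<longleftrightarrow> (\<forall>j\<le>n. (\<Sum>l=j..n. v l) = (\<Sum>l=j..n. w l))"
proof
  assume eq: "\<forall>j\<le>n. (\<Sum>l=j..n. v l) = (\<Sum>l=j..n. w l)"
  show "\<forall>j\<le>n. v j = w j"
  proof (intro allI impI)
    fix j
    assume "j \<le> n"
    have "(\<Sum>l=Suc j..n. v l) = (\<Sum>l=Suc j..n. w l)"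
      using eq by (cases "Suc j \<le> n") auto
    then show "v j = w j"
      using eq[rule_format, OF \<open>j \<le> n\<close>] by (simp add: sum.atLeast_Suc_atMost[OF \<open>j \<le> n\<close>])
  qed
qed simp

section \<open>Balance equations read from the full state\<close>

context interarrival
begin

text \<open>State \<open>n - Suc i\<close> leaves \<open>n - i\<close> customers behind, so it
  reaches the tail from \<open>n - k\<close> with probability \<open>1 - f (k - i)\<close> if
  \<open>i \<le> k\<close> and with probability 0 otherwise. The plain values of \<open>q\<close>
  then cancel between the two sides, except \<open>q (n - Suc k)\<close>.\<close>

lemma balance_tail_iff:
  assumes "k < n"
  shows "(\<Sum>l=n-k..n. q l) = (\<Sum>l=n-k..n. \<Sum>i\<le>n. q i * transition n A \<mu> i l)
    \<longleftrightarrow> q (n - Suc k) = q n * departure_tail A \<mu> k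
      + (\<Sum>i\<le>k. departure_tail A \<mu> (k - i) * q (n - Suc i))"
proof -
  let ?f = "departure_tail A \<mu>"
  let ?c = "\<lambda>i. if n - k \<le> min (i + 1) n then 1 - ?f (min (i + 1) n - (n - k)) else 0"
  have "(\<Sum>l=n-k..n. \<Sum>i\<le>n. q i * transition n A \<mu> i l)
      = (\<Sum>i\<le>n. q i * (\<Sum>l=n-k..n. transition n A \<mu> i l))"
    by (subst sum.swap) (simp add: sum_distrib_left)
  also have "\<dots> = (\<Sum>i\<le>n. q i * ?c i)"
    using assms by (intro sum.cong refl arg_cong2[where f = "(*)"] sum_transition) auto
  also have "\<dots> = (\<Sum>i\<le>n. q (n - i) * ?c (n - i))"
    by (rule sum.reindex_bij_witness[of _ "\<lambda>i. n - i" "\<lambda>i. n - i"]) auto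
  also have "\<dots> = (\<Sum>i<Suc n. q (n - i) * ?c (n - i))"
    by (simp add: lessThan_Suc_atMost)
  \<comment> \<open>The full state is treated apart: its arrival is lost, so the minimum in
    \<open>?c\<close> equals \<open>n\<close> there.\<close>
  also have "\<dots> = q n * (1 - ?f k) + (\<Sum>i<n. q (n - Suc i) * ?c (n - Suc i))"
    using assms by (subst sum.lessThan_Suc_shift) simp
  also have "(\<Sum>i<n. q (n - Suc i) * ?c (n - Suc i)) = (\<Sum>i<n. if i \<le> k then q (n - Suc i) * (1 - ?f (k - i)) else 0)"
  proof (rule sum.cong)
    fix i
    assume "i \<in> {..<n}"
    then have "min (n - Suc i + 1) n = n - i" by auto
    moreover have "n - k \<le> n - i \<longleftrightarrow> i \<le> k" "n - i - (n - k) = k - i"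
      using assms \<open>i \<in> {..<n}\<close> by auto
    ultimately show "q (n - Suc i) * ?c (n - Suc i) = (if i \<le> k then q (n - Suc i) * (1 - ?f (k - i)) else 0)"
      by simp
  qed simp
  also have "\<dots> = (\<Sum>i\<le>k. q (n - Suc i) * (1 - ?f (k - i)))"
    using assms by (intro sum.mono_neutral_cong_right) auto
  \<comment> \<open>The value for \<open>i = k\<close> is split off because the tail on the other
    side stops at \<open>q (n - k)\<close>.\<close>
  also have "\<dots> = (\<Sum>i<k. q (n - Suc i)) + q (n - Suc k) - (\<Sum>i\<le>k. ?f (k - i) * q (n - Suc i))"
    by (simp add: algebra_simps sum_subtractf lessThan_Suc_atMost[symmetric])
  finally have R: "(\<Sum>l=n-k..n. \<Sum>i\<le>n. q i * transition n A \<mu> i l)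
      = q n * (1 - ?f k) + ((\<Sum>i<k. q (n - Suc i)) + q (n - Suc k) - (\<Sum>i\<le>k. ?f (k - i) * q (n - Suc i)))" .
  have "(\<Sum>l=n-k..n. q l) = (\<Sum>i\<le>k. q (n - i))"
    using assms by (intro sum.reindex_bij_witness[of _ "\<lambda>i. n - i" "\<lambda>i. n - i"]) auto
  also have "\<dots> = (\<Sum>i<Suc k. q (n - i))"
    by (simp add: lessThan_Suc_atMost)
  also have "\<dots> = q n + (\<Sum>i<k. q (n - Suc i))"
    by (subst sum.lessThan_Suc_shift) simp
  finally have L: "(\<Sum>l=n-k..n. q l) = q n + (\<Sum>i<k. q (n - Suc i))" .
  show ?thesis unfolding L R by (auto simp: right_diff_distrib)
qed

text \<open>The tail equation at 0 is conservation of mass and holds for every \<open>q\<close>. The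
  remaining tails start at \<open>n - k\<close> with \<open>k < n\<close>, where
  \<open>balance_tail_iff\<close> applies.\<close>

lemma balance_iff:
  "(\<forall>j\<le>n. q j = (\<Sum>i\<le>n. q i * transition n A \<mu> i j))
    \<longleftrightarrow> (\<forall>k<n. q (n - Suc k) = q n * departure_tail A \<mu> k
      + (\<Sum>i\<le>k. departure_tail A \<mu> (k - i) * q (n - Suc i)))" (is "?B \<longleftrightarrow> (\<forall>k<n. ?R k)")
proof -
  let ?w = "\<lambda>j. \<Sum>i\<le>n. q i * transition n A \<mu> i j"
  let ?E = "\<lambda>j. (\<Sum>l=j..n. q l) = (\<Sum>l=j..n. ?w l)"
  have "(\<Sum>l=0..n. ?w l) = (\<Sum>i\<le>n. q i * (\<Sum>l\<le>n. transition n A \<mu> i l))"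
    unfolding atLeast0AtMost by (subst sum.swap) (simp add: sum_distrib_left)
  also have "\<dots> = (\<Sum>i\<le>n. q i)" by (intro sum.cong) (auto simp: sum_transition_all)
  finally have E0: "?E 0" by (simp add: atLeast0AtMost)
  have "(\<forall>j\<le>n. ?E j) \<longleftrightarrow> (\<forall>k<n. ?E (n - k))"
  proof (intro iffI allI impI)
    fix j
    assume "\<forall>k<n. ?E (n - k)" "j \<le> n"
    then show "?E j"
      using E0 by (cases "j = 0") (auto dest: spec[of _ "n - j"])
  qed auto
  then show ?thesis
    unfolding all_tail_sums_eq_iff[of n q ?w] using balance_tail_iff[of _ n q] by auto
qed

text \<open>By \<open>balance_iff\<close>, reading a stationary \<open>q\<close> downwards from
  \<open>n\<close> gives a solution of the recursion of \<open>loss_weight\<close>, hence a multiple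
  of the weights; normalisation fixes \<open>q n\<close>. Existence and uniqueness are both shown
  because the loss probability is a definite description.\<close>

lemma loss_probability_eq:
  assumes "1 \<le> n"
  shows "loss_probability n A \<mu> = 1 / renewal_sum (departure_tail A \<mu>) (n - 1)"
proof -
  let ?f = "departure_tail A \<mu>"
  let ?w = "loss_weight ?f"
  define W where "W = (\<Sum>i\<le>n. ?w i)"
  have W: "renewal_sum ?f (n - 1) = W" using assms by (simp add: renewal_sum_def W_def)
  have f0: "?f 0 < 1" by (rule departure_tail_0)
  have nonneg: "0 \<le> ?w k" for k by (intro loss_weight_nonneg departure_tail_nonneg f0)
  have "?w 0 \<le> W" unfolding W_def by (rule member_le_sum) (auto simp: nonneg)
  then have "W > 0" by simp
  have flip: "(\<Sum>j\<le>n. q j) = (\<Sum>k\<le>n. q (n - k))" for q :: "nat \<Rightarrow> real"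
    by (rule sum.reindex_bij_witness[of _ "\<lambda>i. n - i" "\<lambda>i. n - i"]) auto
  have "(THE p. \<exists>q. stationary n A \<mu> q \<and> p = q n) = 1 / W"
  proof (rule the_equality)
    define q where "q j = ?w (n - j) / W" for j
    have "stationary n A \<mu> q"
      unfolding stationary_def balance_iff
    proof (intro conjI allI impI)
      show "0 \<le> q j" for j using nonneg \<open>W > 0\<close> by (simp add: q_def)
      show "(\<Sum>j\<le>n. q j) = 1"
        using \<open>W > 0\<close> unfolding flip[of q] by (simp add: q_def sum_divide_distrib[symmetric] W_def)
      fix k
      assume "k < n"
      have q: "q (n - Suc i) = ?w (Suc i) / W" if "i \<le> k" for i
        using that \<open>k < n\<close> by (simp add: q_def)
      have "q n * ?f k + (\<Sum>i\<le>k. ?f (k - i) * q (n - Suc i))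
          = (?f k + (\<Sum>i\<le>k. ?f (k - i) * ?w (Suc i))) / W"
        using q by (simp add: add_divide_distrib sum_divide_distrib) (simp add: q_def)
      also have "\<dots> = ?w (Suc k) / W"
        using f0 by (subst loss_weight_Suc[of ?f k]) auto
      finally show "q (n - Suc k) = q n * ?f k + (\<Sum>i\<le>k. ?f (k - i) * q (n - Suc i))"
        by (simp add: q)
    qed
    then show "\<exists>q. stationary n A \<mu> q \<and> 1 / W = q n"
      by (intro exI[of _ q]) (simp add: q_def)
  next
    fix p
    assume "\<exists>q. stationary n A \<mu> q \<and> p = q n"
    then obtain q where q: "stationary n A \<mu> q" "p = q n" by blast
    have "q (n - k) = q (n - 0) * ?w k" if "k \<le> n" for k
    proof (rule loss_weight_unique[where y = "\<lambda>k. q (n - k)", OF _ _ that])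
      show "?f 0 \<noteq> 1" using f0 by simp
    qed (use q(1) in \<open>auto simp: stationary_def balance_iff\<close>)
    then have "(\<Sum>j\<le>n. q j) = q n * W"
      unfolding flip[of q] by (simp add: W_def sum_distrib_left)
    moreover have "(\<Sum>j\<le>n. q j) = 1" using q(1) unfolding stationary_def by blast
    ultimately show "p = 1 / W"
      using q(2) \<open>W > 0\<close> by (simp add: field_simps)
  qed
  then show ?thesis by (simp only: loss_probability_def W)
qed

end

section \<open>Limit of the renewal function in the critical window\<close>

lemma renewal_sum_critical_window:
  fixes f :: "nat \<Rightarrow> nat \<Rightarrow> real" and e \<kappa> K :: "nat \<Rightarrow> real" and N :: "nat \<Rightarrow> nat"
  assumes renewal: "eventually (\<lambda>n. supercritical_renewal (f n) (e n) (\<kappa> n) (K n)) sequentially"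
    and e: "e \<longlonglongrightarrow> 0" and eN: "(\<lambda>n. e n * real (N n)) \<longlonglongrightarrow> C"
    and \<kappa>: "\<kappa> \<longlonglongrightarrow> \<kappa>0" "0 < \<kappa>0" and K: "Bseq K"
  shows "(\<lambda>n. e n * renewal_sum (f n) (N n)) \<longlonglongrightarrow> exp (C / \<kappa>0) - 1"
proof -
  have rate: "(\<lambda>n. e n / \<kappa> n * real (N n)) \<longlonglongrightarrow> C / \<kappa>0"
    using tendsto_divide[OF eN \<kappa>(1)] \<kappa>(2) by simp
  obtain b where b: "\<And>n. \<bar>K n\<bar> \<le> b" using K by (auto simp: Bseq_def)
  show ?thesis
  proof (rule order_tendstoI)
    fix a
    assume "a < exp (C / \<kappa>0) - 1"
    moreover have "(\<lambda>n. exp (e n / \<kappa> n * real (N n)) - 1) \<longlonglongrightarrow> exp (C / \<kappa>0) - 1"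
      by (intro tendsto_intros rate)
    ultimately have "eventually (\<lambda>n. a < exp (e n / \<kappa> n * real (N n)) - 1) sequentially"
      by (simp add: order_tendsto_iff)
    with renewal show "eventually (\<lambda>n. a < e n * renewal_sum (f n) (N n)) sequentially"
    proof eventually_elim
      case (elim n)
      interpret supercritical_renewal "f n" "e n" "\<kappa> n" "K n" by (rule elim(1))
      show ?case using renewal_sum_lower[of "N n"] e_pos elim(2) by (simp add: field_simps)
    qed
  next
    fix a
    assume a: "exp (C / \<kappa>0) - 1 < a"
    \<comment> \<open>This is \<open>e n\<close> times the bound of
      \<open>renewal_sum_upper\<close>, with \<open>r\<close> standing for
      \<open>e n / \<kappa> n * N n\<close>. At \<open>\<eta> = 0\<close> it equals
      \<open>exp r - 1\<close>, so a small \<open>\<eta>\<close> is fixed first and \<open>n\<close>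
      tends to infinity afterwards.\<close>
    let ?U = "\<lambda>\<eta> r. (1 + \<eta>) * ((1 + \<eta>) * exp ((1 + \<eta>) * r) - 1)"
    have "((\<lambda>\<eta>. ?U \<eta> (C / \<kappa>0)) \<longlongrightarrow> ?U 0 (C / \<kappa>0)) (at_right 0)"
      by (intro tendsto_intros)
    then have "eventually (\<lambda>\<eta>. ?U \<eta> (C / \<kappa>0) < a) (at_right 0)"
      using a by (simp add: order_tendsto_iff)
    moreover have "eventually (\<lambda>\<eta>. (0::real) < \<eta>) (at_right 0)"
      by (rule eventually_at_right_less)
    ultimately have "eventually (\<lambda>\<eta>. ?U \<eta> (C / \<kappa>0) < a \<and> 0 < \<eta>) (at_right 0)"
      by (rule eventually_conj)
    then obtain \<eta> where \<eta>: "?U \<eta> (C / \<kappa>0) < a" "0 < \<eta>"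
      using eventually_happens[of _ "at_right (0::real)"] by auto
    have "(\<lambda>n. ?U \<eta> (e n / \<kappa> n * real (N n))) \<longlonglongrightarrow> ?U \<eta> (C / \<kappa>0)"
      by (intro tendsto_intros rate)
    then have U: "eventually (\<lambda>n. ?U \<eta> (e n / \<kappa> n * real (N n)) < a) sequentially"
      using \<eta> by (simp add: order_tendsto_iff)
    \<comment> \<open>Both smallness conditions of \<open>renewal_sum_upper\<close> follow from a
      bound of this form with \<open>c\<close> depending on \<open>\<eta>\<close> only:
      \<open>\<theta>\<^sup>2 * K\<close> is of order \<open>e\<^sup>2\<close>, hence small compared
      with \<open>e\<close>.\<close>
    have small: "eventually (\<lambda>n. c * (e n * b / (\<kappa> n)\<^sup>2) < \<eta>) sequentially" for c
    proof -
      have "(\<lambda>n. c * (e n * b / (\<kappa> n)\<^sup>2)) \<longlonglongrightarrow> c * (0 * b / \<kappa>0\<^sup>2)"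
        using \<kappa>(2) by (intro tendsto_intros e \<kappa>(1)) auto
      then show ?thesis using \<eta>(2) by (simp add: order_tendsto_iff)
    qed
    show "eventually (\<lambda>n. e n * renewal_sum (f n) (N n) < a) sequentially"
      using renewal U small[of "(1 + \<eta>)\<^sup>2 / 2"] small[of "(1 + \<eta>) ^ 3 * (1 + \<eta>)\<^sup>2 / (4 * \<eta>)"]
    proof eventually_elim
      case (elim n)
      interpret supercritical_renewal "f n" "e n" "\<kappa> n" "K n" by (rule elim(1))
      have sq: "((1 + \<eta>) * e n / \<kappa> n)\<^sup>2 * K n \<le> e n * ((1 + \<eta>)\<^sup>2 * (e n * b / (\<kappa> n)\<^sup>2))"
      proof -
        have "((1 + \<eta>) * e n / \<kappa> n)\<^sup>2 * K n \<le> ((1 + \<eta>) * e n / \<kappa> n)\<^sup>2 * b"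
          using b[of n] by (intro mult_left_mono) auto
        also have "\<dots> = e n * ((1 + \<eta>)\<^sup>2 * (e n * b / (\<kappa> n)\<^sup>2))"
          by (simp add: power2_eq_square)
        finally show ?thesis .
      qed
      have "((1 + \<eta>) * e n / \<kappa> n)\<^sup>2 * K n / 2 \<le> e n * ((1 + \<eta>)\<^sup>2 / 2 * (e n * b / (\<kappa> n)\<^sup>2))"
        using sq by simp
      also have "\<dots> \<le> e n * \<eta>" using elim(3) e_pos by (intro mult_left_mono) auto
      finally have 1: "((1 + \<eta>) * e n / \<kappa> n)\<^sup>2 * K n / 2 \<le> \<eta> * e n" by (simp add: mult.commute)
      have "(1 + \<eta>) ^ 3 * ((1 + \<eta>) * e n / \<kappa> n)\<^sup>2 * K n / (4 * \<eta> * e n)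
          = (1 + \<eta>) ^ 3 / (4 * \<eta> * e n) * (((1 + \<eta>) * e n / \<kappa> n)\<^sup>2 * K n)"
        by simp
      also have "\<dots> \<le> (1 + \<eta>) ^ 3 / (4 * \<eta> * e n) * (e n * ((1 + \<eta>)\<^sup>2 * (e n * b / (\<kappa> n)\<^sup>2)))"
        using sq \<eta>(2) e_pos by (intro mult_left_mono) auto
      also have "\<dots> = (1 + \<eta>) ^ 3 * (1 + \<eta>)\<^sup>2 / (4 * \<eta>) * (e n * b / (\<kappa> n)\<^sup>2)"
        using e_pos by simp
      also have "\<dots> \<le> \<eta>" using elim(4) by (rule less_imp_le)
      finally have 2: "(1 + \<eta>) ^ 3 * ((1 + \<eta>) * e n / \<kappa> n)\<^sup>2 * K n / (4 * \<eta> * e n) \<le> \<eta>" .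
      have "e n * renewal_sum (f n) (N n) \<le> ?U \<eta> (e n / \<kappa> n * real (N n))"
        using renewal_sum_upper[OF \<eta>(2) 1 2, of "N n"] e_pos
        by (simp add: pos_le_divide_eq mult.commute[of "e n"] mult.assoc)
      also have "\<dots> < a" by (rule elim(2))
      finally show ?case .
    qed
  qed
qed

theorem theorem3p4:
  fixes A :: "nat \<Rightarrow> real measure" and \<mu> \<epsilon> :: "nat \<Rightarrow> real" and C \<rho>2 :: real
  assumes "\<And>n. n \<ge> 1 \<Longrightarrow> interarrival_law (A n)"
    and "\<And>n. n \<ge> 1 \<Longrightarrow> \<mu> n > 0"
    and "\<And>n. n \<ge> 1 \<Longrightarrow> load (A n) (\<mu> n) = 1 - \<epsilon> n"
    and "\<And>n. n \<ge> 1 \<Longrightarrow> \<epsilon> n > 0"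
    and "\<epsilon> \<longlonglongrightarrow> 0"
    and "(\<lambda>n. \<epsilon> n * real n) \<longlonglongrightarrow> C"
    and "C > 0"
    and "\<And>n. n \<ge> 1 \<Longrightarrow> integrable (A n) (\<lambda>x. x ^ 3)"
    and "Bseq (\<lambda>n. scaled_moment 3 (A n) (\<mu> n))"
    and "(\<lambda>n. scaled_moment 2 (A n) (\<mu> n)) \<longlonglongrightarrow> \<rho>2"
  shows "asymp_equiv (\<lambda>n. loss_probability n (A n) (\<mu> n)) sequentially
           (\<lambda>n. \<epsilon> n * exp (- 2 * C / \<rho>2) / (1 - exp (- 2 * C / \<rho>2)))"
proof -
  \<comment> \<open>With load \<open>1 - \<epsilon> n\<close>, this is the excess of
    \<open>\<rho>\<^sub>1\<close>, the reciprocal of the load, over 1.\<close>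
  define e where "e n = \<epsilon> n / (1 - \<epsilon> n)" for n
  define \<kappa> where "\<kappa> n = scaled_moment 2 (A n) (\<mu> n) / 2" for n
  define K where "K n = scaled_moment 3 (A n) (\<mu> n) / 3 + scaled_moment 2 (A n) (\<mu> n) / 2" for n
  let ?f = "\<lambda>n. departure_tail (A n) (\<mu> n)"
  have ia: "interarrival (A n) (\<mu> n)" if "1 \<le> n" for n
    using assms(1,2)[OF that] by (simp add: interarrival_law_def interarrival_def interarrival_axioms_def)
  have i1: "integrable (A n) (\<lambda>x. x)" if "1 \<le> n" for n
    using assms(1)[OF that] by (simp add: interarrival_law_def)
  have eps: "\<epsilon> n < 1" "scaled_moment 1 (A n) (\<mu> n) = 1 + e n" "0 < e n" if "1 \<le> n" for n
  proof -
    have m: "0 < (\<integral>x. x \<partial>A n)" using assms(1)[OF that] by (simp add: interarrival_law_def)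
    have "load (A n) (\<mu> n) > 0" using m assms(2)[OF that] by (simp add: load_def arrival_rate_def)
    then show "\<epsilon> n < 1" using assms(3)[OF that] by simp
    have "scaled_moment 1 (A n) (\<mu> n) = 1 / load (A n) (\<mu> n)"
      by (simp add: load_def arrival_rate_def scaled_moment_def)
    then show "scaled_moment 1 (A n) (\<mu> n) = 1 + e n"
      using assms(3)[OF that] \<open>\<epsilon> n < 1\<close> by (simp add: e_def field_simps)
    show "0 < e n" using \<open>\<epsilon> n < 1\<close> assms(4)[OF that] by (simp add: e_def)
  qed
  have sm2: "1 \<le> scaled_moment 2 (A n) (\<mu> n)" if "1 \<le> n" for n
    using interarrival.scaled_moment_2_ge[OF ia[OF that] i1[OF that] assms(8)[OF that]] eps(2,3)[OF that]
    by simp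
  have renewal: "supercritical_renewal (?f n) (e n) (\<kappa> n) (K n)" if "1 \<le> n" for n
  proof
    interpret interarrival "A n" "\<mu> n" by (rule ia[OF that])
    show "0 \<le> ?f n j" for j by (rule departure_tail_nonneg)
    show "?f n 0 < 1" by (rule departure_tail_0)
    show "0 < e n" by (rule eps(3)[OF that])
    show "0 < \<kappa> n" using sm2[OF that] by (simp add: \<kappa>_def)
    show "?f n sums (1 + e n)" "(\<lambda>j. real j * ?f n j) sums \<kappa> n" "(\<lambda>j. (real j)\<^sup>2 * ?f n j) sums K n"
      using departure_tail_moment_sums[OF i1[OF that] assms(8)[OF that]] eps(2)[OF that]
      by (simp_all add: \<kappa>_def K_def)
  qed
  \<comment> \<open>This keeps the limit \<open>\<rho>2 / 2\<close> of \<open>\<kappa>\<close>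
    positive and later gives \<open>E < 1\<close>.\<close>
  have "\<rho>2 \<ge> 1"
    using assms(10) by (rule LIMSEQ_le_const) (use sm2 in blast)
  have inv: "(\<lambda>n. 1 / (1 - \<epsilon> n)) \<longlonglongrightarrow> 1 / (1 - 0)"
    by (intro tendsto_intros assms(5)) simp
  have e0: "e \<longlonglongrightarrow> 0"
    using tendsto_mult[OF assms(5) inv] by (simp add: e_def[abs_def])
  \<comment> \<open>The subtracted \<open>e n\<close> comes from the index \<open>n - 1\<close> in
    \<open>loss_probability_eq\<close> and vanishes in the limit.\<close>
  have "(\<lambda>n. \<epsilon> n * real n * (1 / (1 - \<epsilon> n)) - e n) \<longlonglongrightarrow> C * (1 / (1 - 0)) - 0"
    by (intro tendsto_intros assms(6) inv e0)
  then have "(\<lambda>n. \<epsilon> n * real n * (1 / (1 - \<epsilon> n)) - e n) \<longlonglongrightarrow> C" by simp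
  moreover have "eventually (\<lambda>n. \<epsilon> n * real n * (1 / (1 - \<epsilon> n)) - e n = e n * real (n - 1)) sequentially"
    using eventually_ge_at_top[of 1]
    by eventually_elim (simp add: e_def of_nat_diff algebra_simps diff_divide_distrib)
  ultimately have eN: "(\<lambda>n. e n * real (n - 1)) \<longlonglongrightarrow> C"
    by (rule Lim_transform_eventually)
  have lim: "(\<lambda>n. e n * renewal_sum (?f n) (n - 1)) \<longlonglongrightarrow> exp (C / (\<rho>2 / 2)) - 1"
  proof (rule renewal_sum_critical_window[OF _ e0 eN])
    show "eventually (\<lambda>n. supercritical_renewal (?f n) (e n) (\<kappa> n) (K n)) sequentially"
      using eventually_ge_at_top[of 1] by eventually_elim (rule renewal)
    show "\<kappa> \<longlonglongrightarrow> \<rho>2 / 2"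
      unfolding \<kappa>_def[abs_def] by (intro tendsto_intros assms(10)) simp
    show "0 < \<rho>2 / 2" using \<open>\<rho>2 \<ge> 1\<close> by simp
    have "Bseq (\<lambda>n. scaled_moment 2 (A n) (\<mu> n))"
      using assms(10) by (intro convergent_imp_Bseq) (auto simp: convergent_def)
    then obtain b c where "\<bar>scaled_moment 3 (A n) (\<mu> n)\<bar> \<le> b" "\<bar>scaled_moment 2 (A n) (\<mu> n)\<bar> \<le> c" for n
      using assms(9) unfolding Bseq_def real_norm_def by blast
    note bounds = this
    have "norm (K n) \<le> b / 3 + c / 2" for n
      unfolding K_def real_norm_def using bounds(1)[of n] bounds(2)[of n] by linarith
    then show "Bseq K" by (rule BseqI')
  qed
  define E where "E = exp (- 2 * C / \<rho>2)"
  have E: "0 < E" "E < 1" "exp (C / (\<rho>2 / 2)) = 1 / E"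
    using assms(7) \<open>\<rho>2 \<ge> 1\<close> by (auto simp: E_def exp_minus divide_simps)
  \<comment> \<open>In terms of \<open>E\<close> the limit of
    \<open>e n * renewal_sum (?f n) (n - 1)\<close> is \<open>(1 - E) / E\<close>. The factor
    \<open>1 / (1 - \<epsilon> n)\<close> exchanges \<open>e n\<close> for
    \<open>\<epsilon> n\<close>.\<close>
  have "(\<lambda>n. (1 / (1 - \<epsilon> n)) / (e n * renewal_sum (?f n) (n - 1)) * ((1 - E) / E))
      \<longlonglongrightarrow> (1 / (1 - 0)) / (1 / E - 1) * ((1 - E) / E)"
    using lim E by (intro tendsto_intros inv) auto
  then have "(\<lambda>n. (1 / (1 - \<epsilon> n)) / (e n * renewal_sum (?f n) (n - 1)) * ((1 - E) / E)) \<longlonglongrightarrow> 1"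
    using E by (simp add: field_simps)
  moreover have "eventually (\<lambda>n. (1 / (1 - \<epsilon> n)) / (e n * renewal_sum (?f n) (n - 1)) * ((1 - E) / E)
      = loss_probability n (A n) (\<mu> n) / (\<epsilon> n * E / (1 - E))) sequentially"
    using eventually_ge_at_top[of 1]
  proof eventually_elim
    case (elim n)
    then show ?case
      using eps(1)[OF elim] assms(4)[OF elim] E
      by (simp add: interarrival.loss_probability_eq[OF ia[OF elim] elim] e_def)
  qed
  ultimately have "(\<lambda>n. loss_probability n (A n) (\<mu> n) / (\<epsilon> n * E / (1 - E))) \<longlonglongrightarrow> 1"
    by (rule Lim_transform_eventually)
  then show ?thesis by (intro asymp_equivI') (simp add: E_def)
qed

end
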